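(* Let $R$ be a Bézout domain whose quotient field is algebraically closed. Then for any $n\ge 1$, every matrix in $\mathrm{M}_n(R)$ of trace $0$ is a commutator.
   Context: A Bézout domain is a (commutative) integral domain in which every finitely generated ideal is principal. $\mathrm{M}_n(R)$ is the ring of $n\times n$ matrices over $R$. A matrix $C\in \mathrm{M}_n(R)$ is a commutator if there exist $A,B\in \mathrm{M}_n(R)$ with $C=[A,B]:=AB-BA$. *)

theory Defs
  imports
    "HOL-Computational_Algebra.Fraction_Field"
    "HOL-Computational_Algebra.Polynomial"
    "Jordan_Normal_Form.Matrix"
begin

(* A commutative ring is a module over itself; its submodules are its ideals, so
   the span of S with respect to multiplication is the ideal generated by S. *)

definition ideal_generated :: "'a::comm_ring_1 set \<Rightarrow> 'a set" where
  "ideal_generated S = Modules.module.span (*) S"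

lemma module_self: "Modules.module ((*) :: 'a::comm_ring_1 \<Rightarrow> 'a \<Rightarrow> 'a)"
  by unfold_locales (simp_all add: algebra_simps)

lemma ideal_generated_explicit:
  "ideal_generated S = {(\<Sum>a\<in>t. r a * a) | t r. finite t \<and> t \<subseteq> S}"
  unfolding ideal_generated_def by (rule Modules.module.span_explicit[OF module_self])

definition bezout_domain :: "'a::idom itself \<Rightarrow> bool" where
  "bezout_domain _ \<longleftrightarrow>
     (\<forall>S :: 'a set. finite S \<longrightarrow> (\<exists>d. ideal_generated S = ideal_generated {d}))"

(* The library only has this notion as a type class (alg_closed_field), which cannot
   be imposed as a hypothesis on a compound type such as 'a fract. *)

definition algebraically_closed_field :: "'k::field itself \<Rightarrow> bool" where
  "algebraically_closed_field _ \<longleftrightarrow>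
     (\<forall>p :: 'k poly. degree p > 0 \<longrightarrow> (\<exists>x. poly p x = 0))"

definition trace_mat :: "'a::comm_monoid_add mat \<Rightarrow> 'a" where
  "trace_mat A = (\<Sum>i<dim_row A. A $$ (i, i))"

definition commutator_mat :: "nat \<Rightarrow> 'a::comm_ring_1 mat \<Rightarrow> bool" where
  "commutator_mat n C \<longleftrightarrow>
     (\<exists>A \<in> carrier_mat n n. \<exists>B \<in> carrier_mat n n. C = A * B - B * A)"

end

theory Submission
  imports Defs "Jordan_Normal_Form.Char_Poly"
begin

text \<open>
  An upper triangular matrix \<open>C\<close> of trace zero is \<open>[N, B]\<close> with \<open>N\<close> the upper shift: the
  equation determines each diagonal of \<open>B\<close> recursively from the partial sums of a diagonal of
  \<open>C\<close>, and the only obstruction, on the main diagonal, is the trace. Over a Bezout domain whose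
  quotient field is algebraically closed, every square matrix is similar to an upper triangular
  one: an eigenvector over the quotient field can be scaled into the domain, and a unimodular
  matrix carries it to a multiple of the first unit vector.
\<close>

section \<open>Upper triangular matrices as commutators with the shift\<close>

lemma commutator_upper_triangular:
  fixes C :: "'a::comm_ring_1 mat"
  assumes C: "C \<in> carrier_mat n n" and ut: "upper_triangular C" and tr: "trace_mat C = 0"
  shows "commutator_mat n C"
proof -
  \<comment> \<open>Closed form of the recursion
    \<open>b (Suc i) j = C $$ (i,j) + b i (j - 1)\<close>: the sum starts at position
    \<open>(i - 1, j)\<close> and climbs the diagonal, and \<open>min\<close> stops it at the border
    of the matrix. Row \<open>n\<close> of \<open>b\<close> lies outside \<open>B\<close>; it
    expresses the obstruction.\<close>
  define b where "b i j = (\<Sum>u<min i (Suc j). C $$ (i - 1 - u, j - u))" for i j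
  define N where "N = mat n n (\<lambda>(i,j). if j = Suc i then 1 else 0 :: 'a)"
  define B where "B = mat n n (\<lambda>(i,j). b i j)"
  have N: "N \<in> carrier_mat n n" and B: "B \<in> carrier_mat n n"
    unfolding N_def B_def by auto
  have NB: "(N * B) $$ (i,j) = (if Suc i < n then b (Suc i) j else 0)" if "i < n" "j < n" for i j
  proof -
    have "(N * B) $$ (i,j) = (\<Sum>k\<in>{0..<n}. N $$ (i,k) * B $$ (k,j))"
      using that N B by (simp add: scalar_prod_def)
    also have "\<dots> = (\<Sum>k\<in>{0..<n}. if k = Suc i then b k j else 0)"
      using that unfolding N_def B_def by (intro sum.cong) auto
    finally show ?thesis by simp
  qed
  have BN: "(B * N) $$ (i,j) = (if j > 0 then b i (j - 1) else 0)" if "i < n" "j < n" for i j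
  proof -
    have "(B * N) $$ (i,j) = (\<Sum>k\<in>{0..<n}. B $$ (i,k) * N $$ (k,j))"
      using that N B by (simp add: scalar_prod_def)
    \<comment> \<open>At \<open>j = 0\<close> truncated subtraction gives \<open>j - 1 = 0\<close>,
      which would wrongly select \<open>k = 0\<close>; hence the conjunct
      \<open>j > 0\<close>.\<close>
    also have "\<dots> = (\<Sum>k\<in>{0..<n}. if k = j - 1 \<and> j > 0 then b i k else 0)"
      using that unfolding N_def B_def by (intro sum.cong) auto
    finally show ?thesis using that by (cases "j > 0") auto
  qed
  have step: "b (Suc i) j = C $$ (i,j) + (if j > 0 then b i (j - 1) else 0)" for i j
    unfolding b_def by (cases j) (simp_all del: sum.lessThan_Suc add: sum.lessThan_Suc_shift)
  \<comment> \<open>The last row of \<open>N\<close> is zero, so in row \<open>n - 1\<close> the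
    recursion is consistent only if \<open>b n j\<close> vanishes. For \<open>j = n - 1\<close> this
    sum is the trace; for smaller \<open>j\<close> all its terms lie strictly below the main
    diagonal.\<close>
  have last: "b n j = 0" if j: "j < n" for j
  proof (cases "Suc j = n")
    case True
    have "b n j = (\<Sum>u<n. C $$ (n - Suc u, n - Suc u))"
      unfolding b_def using True by (auto intro!: sum.cong)
    also have "\<dots> = trace_mat C"
      unfolding trace_mat_def using C by (subst sum.nat_diff_reindex) auto
    finally show ?thesis using tr by simp
  next
    case False
    then show ?thesis
      unfolding b_def using j C by (intro sum.neutral ballI upper_triangularD[OF ut]) auto
  qed
  have "C = N * B - B * N"
  proof (rule eq_matI)
    fix i j assume "i < dim_row (N * B - B * N)" "j < dim_col (N * B - B * N)"
    then have ij: "i < n" "j < n" using N B by auto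
    have "(N * B - B * N) $$ (i,j) = (N * B) $$ (i,j) - (B * N) $$ (i,j)"
      using ij N B by auto
    also have "\<dots> = b (Suc i) j - (if j > 0 then b i (j - 1) else 0)"
      unfolding NB[OF ij] BN[OF ij] using last[OF ij(2)] ij(1)
      by (cases "Suc i = n") auto
    also have "\<dots> = C $$ (i,j)"
      unfolding step by simp
    finally show "C $$ (i,j) = (N * B - B * N) $$ (i,j)" ..
  qed (use N B C in auto)
  then show ?thesis
    unfolding commutator_mat_def using N B by blast
qed

section \<open>Invariance of commutators and of the trace under similarity\<close>

text \<open>Conjugation is additive and, because \<open>Q * P = 1\<close>, multiplicative; it
  therefore maps brackets to brackets.\<close>

lemma commutator_similar:
  fixes C :: "'a::comm_ring_1 mat"
  assumes C: "C \<in> carrier_mat n n" and sim: "similar_mat C D" and com: "commutator_mat n D"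
  shows "commutator_mat n C"
proof -
  obtain P Q where wit: "similar_mat_wit C D P Q"
    using sim unfolding similar_mat_def by blast
  note PQ = similar_mat_witD2[OF C wit]
  obtain A B where A: "A \<in> carrier_mat n n" and B: "B \<in> carrier_mat n n" and D: "D = A * B - B * A"
    using com unfolding commutator_mat_def by blast
  note [simp] = assoc_mult_mat[of _ n n _ n _ n]
  have conj: "(P * X * Q) * (P * Y * Q) = P * (X * Y) * Q"
    if X: "X \<in> carrier_mat n n" and Y: "Y \<in> carrier_mat n n" for X Y
  proof -
    have "(P * X * Q) * (P * Y * Q) = P * X * (Q * P) * Y * Q"
      using PQ(6,7) X Y by simp
    then show ?thesis unfolding PQ(2) using PQ(6,7) X Y by simp
  qed
  have "C = P * (A * B) * Q - P * (B * A) * Q"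
    unfolding PQ(3) D using PQ(6,7) A B
    by (simp add: mult_minus_distrib_mat[of _ n n _ n] minus_mult_distrib_mat[of _ n n _ _ n])
  then have "C = (P * A * Q) * (P * B * Q) - (P * B * Q) * (P * A * Q)"
    using conj A B by simp
  moreover have "P * A * Q \<in> carrier_mat n n" "P * B * Q \<in> carrier_mat n n"
    using PQ(6,7) A B by auto
  ultimately show ?thesis unfolding commutator_mat_def by blast
qed

lemma trace_mult_commute:
  fixes A :: "'a::comm_ring_1 mat"
  assumes "A \<in> carrier_mat n n" "B \<in> carrier_mat n n"
  shows "trace_mat (A * B) = trace_mat (B * A)"
proof -
  have "trace_mat (A * B) = (\<Sum>i<n. \<Sum>k<n. A $$ (i,k) * B $$ (k,i))"
    unfolding trace_mat_def using assms by (auto simp: scalar_prod_def lessThan_atLeast0)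
  also have "\<dots> = (\<Sum>k<n. \<Sum>i<n. B $$ (k,i) * A $$ (i,k))"
    by (subst sum.swap) (simp add: mult.commute)
  also have "\<dots> = trace_mat (B * A)"
    unfolding trace_mat_def using assms by (auto simp: scalar_prod_def lessThan_atLeast0)
  finally show ?thesis .
qed

lemma trace_similar:
  fixes C :: "'a::comm_ring_1 mat"
  assumes "similar_mat C D"
  shows "trace_mat C = trace_mat D"
proof -
  obtain P Q where wit: "similar_mat_wit C D P Q"
    using assms unfolding similar_mat_def by blast
  define n where "n = dim_row C"
  note PQ = similar_mat_witD[OF n_def wit]
  have "trace_mat C = trace_mat (Q * (P * D))"
    unfolding PQ(3) using PQ(5-7) by (intro trace_mult_commute[of _ n]) auto
  also have "Q * (P * D) = (Q * P) * D"
    using PQ(5-7) by (simp add: assoc_mult_mat[of _ n n _ n _ n])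
  finally show ?thesis using PQ(2,5) by simp
qed

section \<open>Unimodular reduction of a vector over a Bezout domain\<close>

text \<open>If \<open>g = s * x + t * y\<close> generates the ideal of \<open>x = x' * g\<close> and
  \<open>y = y' * g\<close>, the rows \<open>(s, t)\<close> and \<open>(- y', x')\<close> form a
  matrix of determinant 1 whose second row annihilates \<open>(x, y)\<close>.\<close>

lemma bezout_transvection:
  fixes x y :: "'a::idom"
  assumes "bezout_domain TYPE('a)"
  obtains a b c d :: 'a where "a * d - b * c = 1" "c * x + d * y = 0"
proof -
  have "\<exists>g x' y' s t. x = x' * g \<and> y = y' * g \<and> g = s * x + t * y"
  proof -
    interpret M: Modules.module "(*) :: 'a \<Rightarrow> 'a \<Rightarrow> 'a" by (rule module_self)
    obtain g where g: "M.span {x, y} = M.span {g}"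
      using assms unfolding bezout_domain_def ideal_generated_def by (meson finite.intros)
    have "x \<in> M.span {g}" "y \<in> M.span {g}"
      unfolding g[symmetric] by (simp_all add: M.span_base)
    then obtain x' y' where xy: "x = x' * g" "y = y' * g"
      unfolding M.span_singleton by blast
    have "g \<in> M.span {x, y}"
      unfolding g by (simp add: M.span_base)
    then obtain s where "g - s * x \<in> M.span {y}"
      unfolding M.span_insert[of x "{y}"] by blast
    then obtain t where "g - s * x = t * y"
      unfolding M.span_singleton by blast
    then have "g = s * x + t * y"
      by (simp add: diff_eq_eq add.commute)
    then show ?thesis using xy by blast
  qed
  then obtain g x' y' s t where x: "x = x' * g" and y: "y = y' * g" and gst: "g = s * x + t * y"
    by blast
  show thesis
  \<comment> \<open>For \<open>g = 0\<close> the factor \<open>g\<close> cannot be cancelled, but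
    then \<open>x = y = 0\<close> and the identity works. In both instantiations of
    \<open>that\<close> the order is \<open>a, d, b, c\<close>.\<close>
  proof (cases "g = 0")
    case True
    then show thesis using that[of 1 1 0 0] x y by simp
  next
    case False
    have "g * (s * x' + t * y') = s * (x' * g) + t * (y' * g)"
      by (simp add: algebra_simps)
    also have "\<dots> = g * 1"
      unfolding x[symmetric] y[symmetric] gst[symmetric] by simp
    finally have "s * x' + t * y' = 1" using False by simp
    then show thesis using that[of s x' t "- y'"] x y by (simp add: algebra_simps)
  qed
qed

text \<open>The 2 by 2 matrix with rows \<open>(a, b)\<close> and \<open>(c, d)\<close> acting on
  coordinates \<open>0\<close> and \<open>k\<close>, extended by the identity: an analogue of a
  Givens rotation.\<close>

definition plane_mat :: "nat \<Rightarrow> nat \<Rightarrow> 'a::comm_ring_1 \<Rightarrow> 'a \<Rightarrow> 'a \<Rightarrow> 'a \<Rightarrow> 'a mat" where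
  "plane_mat n k a b c d = mat n n (\<lambda>(i,j).
     if i = 0 then (if j = 0 then a else if j = k then b else 0)
     else if i = k then (if j = 0 then c else if j = k then d else 0)
     else if i = j then 1 else 0)"

lemma plane_mat_carrier [simp]: "plane_mat n k a b c d \<in> carrier_mat n n"
  unfolding plane_mat_def by simp

lemma plane_mat_mult_vec:
  fixes v :: "'a::comm_ring_1 vec"
  assumes v: "v \<in> carrier_vec n" and k: "0 < k" "k < n" and i: "i < n"
  shows "(plane_mat n k a b c d *\<^sub>v v) $ i =
    (if i = 0 then a * v $ 0 + b * v $ k
     else if i = k then c * v $ 0 + d * v $ k else v $ i)"
proof -
  \<comment> \<open>\<open>S\<close> contains the support of row \<open>i\<close>.\<close>
  define S where "S = (if i = 0 \<or> i = k then {0, k} else {i})"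
  have "(plane_mat n k a b c d *\<^sub>v v) $ i = (\<Sum>j\<in>{0..<n}. plane_mat n k a b c d $$ (i,j) * v $ j)"
    using v i by (auto simp: scalar_prod_def plane_mat_def intro!: sum.cong)
  also have "\<dots> = (\<Sum>j\<in>S. plane_mat n k a b c d $$ (i,j) * v $ j)"
    using k i unfolding S_def
    by (intro sum.mono_neutral_right) (auto simp: plane_mat_def)
  finally show ?thesis
    using k i unfolding S_def by (auto simp: plane_mat_def)
qed

text \<open>The second factor carries the adjugate of the 2 by 2 block, which is its inverse when
  the determinant is 1.\<close>

lemma plane_mat_inverse:
  fixes a b c d :: "'a::comm_ring_1"
  assumes det: "a * d - b * c = 1" and k: "0 < k" "k < n"
  shows "plane_mat n k a b c d * plane_mat n k d (- b) (- c) a = 1\<^sub>m n"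
proof (rule eq_matI)
  fix i j assume "i < dim_row (1\<^sub>m n :: 'a mat)" "j < dim_col (1\<^sub>m n :: 'a mat)"
  then have ij: "i < n" "j < n" by auto
  let ?G = "plane_mat n k a b c d" and ?H = "plane_mat n k d (- b) (- c) a"
  have "(?G * ?H) $$ (i,j) = (?G *\<^sub>v col ?H j) $ i"
    using ij by (simp add: plane_mat_def)
  also have "\<dots> = 1\<^sub>m n $$ (i,j)"
    using ij k det by (subst plane_mat_mult_vec) (auto simp: plane_mat_def algebra_simps)
  finally show "(?G * ?H) $$ (i,j) = 1\<^sub>m n $$ (i,j)" .
qed (auto simp: plane_mat_def)

text \<open>Coordinates \<open>1, 2, ...\<close> are cleared one after another against the pivot in
  coordinate \<open>0\<close>. The inverse \<open>V\<close> is built along with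
  \<open>U\<close>.\<close>

lemma unimodular_reduction:
  fixes v :: "'a::idom vec"
  assumes bez: "bezout_domain TYPE('a)" and v: "v \<in> carrier_vec n"
  obtains U V where "U \<in> carrier_mat n n" "V \<in> carrier_mat n n" "U * V = 1\<^sub>m n" "V * U = 1\<^sub>m n"
    "\<And>i. 0 < i \<Longrightarrow> i < n \<Longrightarrow> (U *\<^sub>v v) $ i = 0"
proof -
  have "\<exists>U V. U \<in> carrier_mat n n \<and> V \<in> carrier_mat n n \<and> U * V = 1\<^sub>m n \<and> V * U = 1\<^sub>m n
      \<and> (\<forall>i. 0 < i \<longrightarrow> i < k \<longrightarrow> (U *\<^sub>v v) $ i = 0)" if "k \<le> n" for k
    using that
  proof (induction k)
    case 0
    show ?case by (intro exI[of _ "1\<^sub>m n"]) auto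
  next
    case (Suc k)
    then obtain U V where U: "U \<in> carrier_mat n n" and V: "V \<in> carrier_mat n n"
      and UV: "U * V = 1\<^sub>m n" and VU: "V * U = 1\<^sub>m n"
      and zero: "\<And>i. 0 < i \<Longrightarrow> i < k \<Longrightarrow> (U *\<^sub>v v) $ i = 0"
      by auto
    show ?case
    \<comment> \<open>Coordinate \<open>0\<close> is the pivot and is not cleared, so the first step
      changes nothing.\<close>
    proof (cases "k = 0")
      case True
      then show ?thesis using U V UV VU by (intro exI[of _ U] exI[of _ V]) auto
    next
      case False
      then have k: "0 < k" "k < n" using Suc.prems by auto
      obtain a b c d where det: "a * d - b * c = 1"
        and kill: "c * (U *\<^sub>v v) $ 0 + d * (U *\<^sub>v v) $ k = 0"
        using bezout_transvection[OF bez] by metis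
      define G where "G = plane_mat n k a b c d"
      define H where "H = plane_mat n k d (- b) (- c) a"
      have G: "G \<in> carrier_mat n n" and H: "H \<in> carrier_mat n n"
        unfolding G_def H_def by simp_all
      have GH: "G * H = 1\<^sub>m n"
        unfolding G_def H_def by (rule plane_mat_inverse[OF det k])
      \<comment> \<open>The adjugate of the adjugate is the original block, so the same lemma gives
        the other order.\<close>
      have HG: "H * G = 1\<^sub>m n"
        using plane_mat_inverse[of d a "- b" "- c", OF _ k] det
        unfolding G_def H_def by (simp add: algebra_simps)
      note [simp] = assoc_mult_mat[of _ n n _ n _ n]
      have "(G * U) * (V * H) = G * (U * V) * H" using G H U V by simp
      then have 1: "(G * U) * (V * H) = 1\<^sub>m n" unfolding UV using G H GH by simp
      have "(V * H) * (G * U) = V * (H * G) * U" using G H U V by simp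
      then have 2: "(V * H) * (G * U) = 1\<^sub>m n" unfolding HG using U V VU by simp
      \<comment> \<open>\<open>G\<close> alters only coordinates \<open>0\<close> and
        \<open>k\<close>, so the zeros obtained earlier survive.\<close>
      have "(G * U *\<^sub>v v) $ i = 0" if i: "0 < i" "i < Suc k" for i
      proof -
        have "(G * U *\<^sub>v v) $ i = (G *\<^sub>v (U *\<^sub>v v)) $ i"
          using G U v by simp
        also have "\<dots> = 0"
          unfolding G_def using U v k i zero kill
          by (subst plane_mat_mult_vec[where n = n]) auto
        finally show ?thesis .
      qed
      then show ?thesis using 1 2 G H U V
        by (intro exI[of _ "G * U"] exI[of _ "V * H"]) auto
    qed
  qed
  from this[of n] that show thesis by blast
qed

section \<open>Eigenvectors and triangularization\<close>

lemma mult_mat_smult_vec: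
  fixes A :: "'a::comm_ring_1 mat"
  assumes "A \<in> carrier_mat nr nc" "v \<in> carrier_vec nc"
  shows "A *\<^sub>v (k \<cdot>\<^sub>v v) = k \<cdot>\<^sub>v (A *\<^sub>v v)"
  using assms by (intro eq_vecI) auto

text \<open>The eigenvalue is kept as a fraction \<open>p / q\<close>, so that no integral closedness is needed.\<close>

lemma fract_eigenvector:
  fixes C :: "'a::idom mat"
  assumes ac: "algebraically_closed_field TYPE('a fract)"
    and C: "C \<in> carrier_mat n n" and n: "n > 0"
  obtains p q v where "q \<noteq> 0" "v \<in> carrier_vec n" "v \<noteq> 0\<^sub>v n" "q \<cdot>\<^sub>v (C *\<^sub>v v) = p \<cdot>\<^sub>v v"
proof -
  let ?h = "to_fract :: 'a \<Rightarrow> 'a fract"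
  interpret inj_comm_ring_hom ?h by unfold_locales auto
  let ?C = "map_mat ?h C"
  have C': "?C \<in> carrier_mat n n" using C by auto
  obtain l where "poly (char_poly ?C) l = 0"
    using ac degree_monic_char_poly[OF C'] n unfolding algebraically_closed_field_def by metis
  then obtain w where w: "w \<in> carrier_vec n" "w \<noteq> 0\<^sub>v n" and ev: "?C *\<^sub>v w = l \<cdot>\<^sub>v w"
    using eigenvalue_root_char_poly[OF C'] C' unfolding eigenvalue_def eigenvector_def by auto
  obtain p q where l: "l = Fraction_Field.Fract p q" and q: "q \<noteq> 0" by (cases l)
  have pq: "?h q * l = ?h p" using q unfolding l to_fract_def by (simp add: eq_fract)
  \<comment> \<open>Over the quotient field \<open>M\<close> becomes \<open>q\<close> times
    \<open>C - l\<close>, hence singular. Its determinant commutes with the embedding and so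
    vanishes already in the domain, which yields a kernel vector \<open>v\<close> there without
    clearing denominators of \<open>w\<close>.\<close>
  define M where "M = q \<cdot>\<^sub>m C - p \<cdot>\<^sub>m 1\<^sub>m n"
  have M: "M \<in> carrier_mat n n" unfolding M_def using C by auto
  \<comment> \<open>Polymorphic in \<open>'b\<close>, for use over the quotient field as well as
    over the domain.\<close>
  have mult: "(x \<cdot>\<^sub>m X - y \<cdot>\<^sub>m 1\<^sub>m n) *\<^sub>v u = x \<cdot>\<^sub>v (X *\<^sub>v u) - y \<cdot>\<^sub>v u"
    if "X \<in> carrier_mat n n" "u \<in> carrier_vec n" for x y :: "'b::comm_ring_1" and X u
    using that by (subst minus_mult_distrib_mat_vec[of _ n n]) auto
  have "map_mat ?h M = ?h q \<cdot>\<^sub>m ?C - ?h p \<cdot>\<^sub>m 1\<^sub>m n"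
    unfolding M_def using C by (intro eq_matI) auto
  then have "map_mat ?h M *\<^sub>v w = ?h q \<cdot>\<^sub>v (l \<cdot>\<^sub>v w) - ?h p \<cdot>\<^sub>v w"
    using mult[OF C' w(1)] ev by simp
  also have "\<dots> = 0\<^sub>v n"
    using w(1) pq by (simp add: smult_smult_assoc)
  finally have "map_mat ?h M *\<^sub>v w = 0\<^sub>v n" .
  then have "det (map_mat ?h M) = 0"
    using w M det_0_iff_vec_prod_zero[of "map_mat ?h M" n] by auto
  then have "det M = 0" by (simp add: hom_det)
  then obtain v where v: "v \<in> carrier_vec n" "v \<noteq> 0\<^sub>v n" "M *\<^sub>v v = 0\<^sub>v n"
    using det_0_iff_vec_prod_zero[OF M] by auto
  have eq0: "q \<cdot>\<^sub>v (C *\<^sub>v v) - p \<cdot>\<^sub>v v = 0\<^sub>v n"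
    using mult[OF C v(1), of q p] v(3) unfolding M_def by simp
  have "q \<cdot>\<^sub>v (C *\<^sub>v v) = p \<cdot>\<^sub>v v"
  proof (rule eq_vecI)
    fix i assume "i < dim_vec (p \<cdot>\<^sub>v v)"
    then show "(q \<cdot>\<^sub>v (C *\<^sub>v v)) $ i = (p \<cdot>\<^sub>v v) $ i"
      using arg_cong[OF eq0, of "\<lambda>u. u $ i"] C v(1) by auto
  qed (use C v(1) in auto)
  then show thesis using that q v by blast
qed

text \<open>After the base change by \<open>U\<close> the eigenvector is \<open>w\<close>, supported
  in coordinate \<open>0\<close>. Row \<open>i > 0\<close> of the eigenvector equation then reads
  \<open>q * (D $$ (i,0) * w $ 0) = 0\<close>, and both \<open>q\<close> and \<open>w $ 0\<close>
  cancel in a domain.\<close>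

lemma similar_first_column:
  fixes C :: "'a::idom mat"
  assumes bez: "bezout_domain TYPE('a)" and ac: "algebraically_closed_field TYPE('a fract)"
    and C: "C \<in> carrier_mat n n" and n: "n > 0"
  obtains D where "similar_mat C D" "D \<in> carrier_mat n n"
    "\<And>i. 0 < i \<Longrightarrow> i < n \<Longrightarrow> D $$ (i,0) = 0"
proof -
  obtain p q v where q: "q \<noteq> 0" and v: "v \<in> carrier_vec n" "v \<noteq> 0\<^sub>v n"
    and ev: "q \<cdot>\<^sub>v (C *\<^sub>v v) = p \<cdot>\<^sub>v v"
    using fract_eigenvector[OF ac C n] .
  obtain U V where U: "U \<in> carrier_mat n n" and V: "V \<in> carrier_mat n n"
    and UV: "U * V = 1\<^sub>m n" and VU: "V * U = 1\<^sub>m n"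
    and zero: "\<And>i. 0 < i \<Longrightarrow> i < n \<Longrightarrow> (U *\<^sub>v v) $ i = 0"
    using unimodular_reduction[OF bez v(1)] by metis
  define w where "w = U *\<^sub>v v"
  define D where "D = U * C * V"
  have w: "w \<in> carrier_vec n" and D: "D \<in> carrier_mat n n"
    unfolding w_def D_def using U C V v by auto
  have Vw: "V *\<^sub>v w = v"
    unfolding w_def using assoc_mult_mat_vec[OF V U v(1)] v(1) VU by simp
  have w0: "w $ 0 \<noteq> 0"
  proof
    assume "w $ 0 = 0"
    then have "w $ i = 0" if "i < n" for i
      using that zero unfolding w_def[symmetric] by (cases "i = 0") auto
    then have "w = 0\<^sub>v n" using w by (intro eq_vecI) auto
    then have "v = V *\<^sub>v 0\<^sub>v n" using Vw by simp
    also have "\<dots> = 0\<^sub>v n" using V by (intro eq_vecI) auto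
    finally show False using v by simp
  qed
  have "D *\<^sub>v w = U *\<^sub>v (C *\<^sub>v v)"
    unfolding D_def using U C V w v by (simp add: assoc_mult_mat_vec[of _ n n _ n] Vw)
  then have "q \<cdot>\<^sub>v (D *\<^sub>v w) = U *\<^sub>v (q \<cdot>\<^sub>v (C *\<^sub>v v))"
    using U C v by (simp add: mult_mat_smult_vec[of _ n n])
  also have "\<dots> = p \<cdot>\<^sub>v w"
    unfolding ev w_def using U v by (simp add: mult_mat_smult_vec[of _ n n])
  finally have Dw: "q \<cdot>\<^sub>v (D *\<^sub>v w) = p \<cdot>\<^sub>v w" .
  have "D $$ (i,0) = 0" if i: "0 < i" "i < n" for i
  proof -
    have "(D *\<^sub>v w) $ i = (\<Sum>j\<in>{0..<n}. D $$ (i,j) * w $ j)"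
      using D w i by (auto simp: scalar_prod_def intro!: sum.cong)
    also have "\<dots> = (\<Sum>j\<in>{0}. D $$ (i,j) * w $ j)"
      using zero n unfolding w_def[symmetric] by (intro sum.mono_neutral_right) auto
    finally have "q * (D $$ (i,0) * w $ 0) = 0"
      using arg_cong[OF Dw, of "\<lambda>u. u $ i"] D w i zero unfolding w_def[symmetric] by auto
    then show ?thesis using q w0 by simp
  qed
  moreover have "similar_mat C D"
    using similar_mat_wit_sym[OF similar_mat_witI[OF UV VU D_def D C U V]]
    unfolding similar_mat_def by blast
  ultimately show thesis using that D by blast
qed

text \<open>Induction on the size: once the first column is cleared, the lower right block is
  triangularized by the induction hypothesis, and its base change is extended by a 1 in the
  corner.\<close>

lemma similar_upper_triangular:
  fixes C :: "'a::idom mat"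
  assumes bez: "bezout_domain TYPE('a)" and ac: "algebraically_closed_field TYPE('a fract)"
    and "C \<in> carrier_mat n n"
  shows "\<exists>T. similar_mat C T \<and> upper_triangular T"
  using assms(3)
proof (induction n arbitrary: C)
  case 0
  then have "upper_triangular C" by auto
  then show ?case using similar_mat_refl[OF 0] by blast
next
  case (Suc n)
  obtain D where CD: "similar_mat C D" and D: "D \<in> carrier_mat (Suc n) (Suc n)"
    and col: "\<And>i. 0 < i \<Longrightarrow> i < Suc n \<Longrightarrow> D $$ (i,0) = 0"
    using similar_first_column[OF bez ac Suc.prems] by auto
  obtain A1 A2 A3 A4 where spl: "split_block D 1 1 = (A1,A2,A3,A4)"
    by (cases "split_block D 1 1") auto
  note blk = split_block[OF spl, of n n]
  have A1: "A1 \<in> carrier_mat 1 1" and A2: "A2 \<in> carrier_mat 1 n"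
    and A3: "A3 \<in> carrier_mat n 1" and A4: "A4 \<in> carrier_mat n n"
    and Dblk: "D = four_block_mat A1 A2 A3 A4"
    using blk D by auto
  have A3_0: "A3 = 0\<^sub>m n 1"
    using spl col D unfolding split_block_def Let_def by (intro eq_matI) auto
  obtain T where "similar_mat A4 T" and T: "upper_triangular T"
    using Suc.IH[OF A4] by blast
  then obtain P Q where wit: "similar_mat_wit A4 T P Q"
    unfolding similar_mat_def by blast
  note PQ = similar_mat_witD2[OF A4 wit]
  \<comment> \<open>\<open>E\<close> is \<open>D\<close> conjugated by the block diagonal matrix of
    \<open>1\<close> and \<open>P\<close>, which turns the upper right block \<open>A2\<close> into
    \<open>A2 * P\<close>.\<close>
  define E where "E = four_block_mat A1 (A2 * P) (0\<^sub>m n 1) T"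
  have "A2 = 1\<^sub>m 1 * (A2 * P) * Q"
    using A2 PQ by (simp add: assoc_mult_mat[of A2 1 n P n Q n] left_mult_one_mat[of _ 1 n])
  moreover have "0\<^sub>m n 1 = P * 0\<^sub>m n 1 * 1\<^sub>m 1" using PQ by simp
  ultimately have "similar_mat D E"
    unfolding Dblk A3_0 E_def similar_mat_def
    using similar_mat_wit_four_block[OF similar_mat_wit_refl[OF A1] wit _ _ A1 A4
        zero_carrier_mat mult_carrier_mat[OF A2 PQ(6)]] by blast
  moreover have "upper_triangular E"
    unfolding E_def using A1 A2 PQ upper_triangularD[OF T]
    by (intro upper_triangularI) auto
  ultimately show ?case using similar_mat_trans[OF CD] by blast
qed

theorem theorem2p5:
  fixes n :: nat and C :: "'a::idom mat"
  assumes "bezout_domain TYPE('a)"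
    and "algebraically_closed_field TYPE('a fract)"
    and "n \<ge> 1"
    and "C \<in> carrier_mat n n"
    and "trace_mat C = 0"
  shows "commutator_mat n C"
proof -
  obtain T where sim: "similar_mat C T" and T: "upper_triangular T"
    using similar_upper_triangular[OF assms(1,2,4)] by blast
  obtain m where "C \<in> carrier_mat m m" "T \<in> carrier_mat m m"
    using similar_matD[OF sim] by auto
  then have "T \<in> carrier_mat n n" using assms(4) by auto
  \<comment> \<open>Similarity carries the zero trace over to \<open>T\<close>.\<close>
  then have "commutator_mat n T"
    using commutator_upper_triangular T trace_similar[OF sim] assms(5) by metis
  then show ?thesis
    by (rule commutator_similar[OF assms(4) sim])
qed

end
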